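(* Let $\mathcal{A}$ be a ternary Jordan algebra over a field $\mathrm{F}$, let $U$ be a subspace of $\mathcal{A}$ with $\mathcal{A}=U\oplus[\![\mathcal{A},\mathcal{A},\mathcal{A}]\!]$ (vector space direct sum), and let $\tilde{\mathcal{A}}$ be the ternary Jordan algebra and $l_u:QDer(\mathcal{A})\to\mathrm{End}(\tilde{\mathcal{A}})$ the map associated with $\mathcal{A}$ and $U$ as defined in the context. If $Z(\mathcal{A})=\{0\}$, then $$Der(\tilde{\mathcal{A}})=l_u(QDer(\mathcal{A}))\dotplus ZDer(\tilde{\mathcal{A}}),$$ where $\dotplus$ denotes the direct sum of vector spaces.
   Context: A ternary Jordan algebra over a field $\mathrm{F}$ is an $\mathrm{F}$-vector space $\mathcal{A}$ with a trilinear map $[\![\cdot,\cdot,\cdot]\!]:\mathcal{A}^3\to\mathcal{A}$ that is invariant under all permutations of its arguments and such that for all $x_2,x_3,y_2,y_3\in\mathcal{A}$ the commutator $[R_{(x_2,x_3)},R_{(y_2,y_3)}]$ is a derivation of $\mathcal{A}$, where $R_{(y_2,y_3)}(y)=[\![y,y_2,y_3]\!]$. A derivation is a linear map $D$ with $D([\![x,y,z]\!])=[\![D(x),y,z]\!]+[\![x,D(y),z]\!]+[\![x,y,D(z)]\!]$ for all $x,y,z$; $Der(\cdot)$ is the set of derivations. $[\![\mathcal{A},\mathcal{A},\mathcal{A}]\!]$ denotes the linear span of all products. $Z(\mathcal{A})=\{z\in\mathcal{A} : [\![x,y,z]\!]=0\ \forall x,y\in\mathcal{A}\}$. $ZDer(\mathcal{A})$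 (center derivations) is the set of linear maps $f:\mathcal{A}\to\mathcal{A}$ with $f(\mathcal{A})\subseteq Z(\mathcal{A})$ and $f([\![\mathcal{A},\mathcal{A},\mathcal{A}]\!])=0$; the same definitions apply to $\tilde{\mathcal{A}}$. $QDer(\mathcal{A})$ (quasiderivations) is the set of linear maps $f:\mathcal{A}\to\mathcal{A}$ for which there is a linear map $f':\mathcal{A}\to\mathcal{A}$ with $[\![f(x),y,z]\!]+[\![x,f(y),z]\!]+[\![x,y,f(z)]\!]=f'([\![x,y,z]\!])$ for all $x,y,z$. Let $t$ be an indeterminate and write $t^i$ also for its class in $\mathrm{F}[t]/\langle t^4\rangle$. $\tilde{\mathcal{A}}$ is the subspace $\mathcal{A}t+\mathcal{A}t^2+\mathcal{A}t^3$ of $\mathcal{A}\otimes(\mathrm{F}[t]/\langle t^4\rangle)$, where $xt^i:=x\otimes t^i$, with trilinear product $[\![xt^i,yt^j,zt^k]\!]=[\![x,y,z]\!]t^{i+j+k}$ for $i,j,k\in\{1,2,3\}$ (so it equals $[\![x,y,z]\!]t^3$ if $i=j=k=1$ and $0$ otherwise). It is a ternary Jordan algebra, and $\tilde{\mathcal{A}}=\mathcal{A}t+\mathcal{A}t^2+[\![\mathcal{A},\mathcal{A},\mathcal{A}]\!]t^3+Ut^3$. The map $l_u:QDer(\mathcal{A})\to\mathrm{End}(\tilde{\mathcal{A}})$ is defined by $l_u(f)(at+bt^2+ct^3+ut^3)=f(a)t+f'(c)t^3$ for $a,b\in\mathcal{A}$, $c\in[\![\mathcal{A},\mathcal{A},\mathcal{A}]\!]$,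 $u\in U$, where $f'$ is any linear map satisfying the defining identity of the quasiderivation $f$ (the result does not depend on the choice of $f'$). *)

theory Defs
  imports Complex_Main "HOL-Library.Product_Plus" "HOL-Library.Function_Algebras"
begin

text \<open>
  The underlying vector space of an algebra is a whole type \<open>'a\<close> with a scalar multiplication
  \<open>s :: 'f::field \<Rightarrow> 'a \<Rightarrow> 'a\<close> satisfying the locale \<^locale>\<open>vector_space\<close>;
  no restriction is made on its dimension or on the characteristic of \<open>'f\<close>.
\<close>

definition derivations ::
    "('f::field \<Rightarrow> 'a::ab_group_add \<Rightarrow> 'a) \<Rightarrow> ('a \<Rightarrow> 'a \<Rightarrow> 'a \<Rightarrow> 'a) \<Rightarrow> ('a \<Rightarrow> 'a) set" where
  "derivations s T = {D. Vector_Spaces.linear s s D \<and>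
     (\<forall>x y z. D (T x y z) = T (D x) y z + T x (D y) z + T x y (D z))}"

definition right_mult :: "('a \<Rightarrow> 'a \<Rightarrow> 'a \<Rightarrow> 'a) \<Rightarrow> 'a \<Rightarrow> 'a \<Rightarrow> 'a \<Rightarrow> 'a" where
  "right_mult T y2 y3 = (\<lambda>y. T y y2 y3)"

definition commutator :: "('a \<Rightarrow> 'a::ab_group_add) \<Rightarrow> ('a \<Rightarrow> 'a) \<Rightarrow> 'a \<Rightarrow> 'a" where
  "commutator f g = (\<lambda>x. f (g x) - g (f x))"

locale ternary_jordan_algebra = vector_space scale
  for scale :: "'f::field \<Rightarrow> 'a::ab_group_add \<Rightarrow> 'a" +
  fixes T :: "'a \<Rightarrow> 'a \<Rightarrow> 'a \<Rightarrow> 'a"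
  assumes linear_1: "Vector_Spaces.linear scale scale (\<lambda>x. T x y z)"
    and linear_2: "Vector_Spaces.linear scale scale (\<lambda>y. T x y z)"
    and linear_3: "Vector_Spaces.linear scale scale (\<lambda>z. T x y z)"
    and symmetric: "T x z y = T x y z" "T y x z = T x y z" "T y z x = T x y z"
      "T z x y = T x y z" "T z y x = T x y z"
    and commutator_derivation:
      "commutator (right_mult T x2 x3) (right_mult T y2 y3) \<in> derivations scale T"

text \<open>The span of all products.\<close>

definition product_span ::
    "('f::field \<Rightarrow> 'a::ab_group_add \<Rightarrow> 'a) \<Rightarrow> ('a \<Rightarrow> 'a \<Rightarrow> 'a \<Rightarrow> 'a) \<Rightarrow> 'a set" where
  "product_span s T = module.span s {T x y z | x y z. True}"

definition algebra_center :: "('a \<Rightarrow> 'a \<Rightarrow> 'a \<Rightarrow> 'a::zero) \<Rightarrow> 'a set" where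
  "algebra_center T = {z. \<forall>x y. T x y z = 0}"

definition center_derivations ::
    "('f::field \<Rightarrow> 'a::ab_group_add \<Rightarrow> 'a) \<Rightarrow> ('a \<Rightarrow> 'a \<Rightarrow> 'a \<Rightarrow> 'a) \<Rightarrow> ('a \<Rightarrow> 'a) set" where
  "center_derivations s T = {f. Vector_Spaces.linear s s f \<and>
     range f \<subseteq> algebra_center T \<and> (\<forall>w \<in> product_span s T. f w = 0)}"

definition quasi_companion ::
    "('f::field \<Rightarrow> 'a::ab_group_add \<Rightarrow> 'a) \<Rightarrow> ('a \<Rightarrow> 'a \<Rightarrow> 'a \<Rightarrow> 'a)
      \<Rightarrow> ('a \<Rightarrow> 'a) \<Rightarrow> ('a \<Rightarrow> 'a) \<Rightarrow> bool" where
  "quasi_companion s T f f' \<longleftrightarrow> Vector_Spaces.linear s s f' \<and>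
     (\<forall>x y z. T (f x) y z + T x (f y) z + T x y (f z) = f' (T x y z))"

definition quasiderivations ::
    "('f::field \<Rightarrow> 'a::ab_group_add \<Rightarrow> 'a) \<Rightarrow> ('a \<Rightarrow> 'a \<Rightarrow> 'a \<Rightarrow> 'a) \<Rightarrow> ('a \<Rightarrow> 'a) set" where
  "quasiderivations s T =
     {f. Vector_Spaces.linear s s f \<and> (\<exists>f'. quasi_companion s T f f')}"

text \<open>\<open>V\<close> is the internal direct sum of the subspaces \<open>X\<close> and \<open>Y\<close>.\<close>

definition is_direct_sum ::
    "('f::field \<Rightarrow> 'v::ab_group_add \<Rightarrow> 'v) \<Rightarrow> 'v set \<Rightarrow> 'v set \<Rightarrow> 'v set \<Rightarrow> bool" where
  "is_direct_sum s V X Y \<longleftrightarrow> module.subspace s X \<and> module.subspace s Y \<and>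
     V = {x + y | x y. x \<in> X \<and> y \<in> Y} \<and> X \<inter> Y = {0}"

text \<open>
  The space \<open>A t + A t\<^sup>2 + A t\<^sup>3\<close> inside \<open>A \<otimes> F[t]/\<langle>t\<^sup>4\<rangle>\<close>: since the classes of \<open>1, t, t\<^sup>2, t\<^sup>3\<close>
  form a basis of \<open>F[t]/\<langle>t\<^sup>4\<rangle>\<close>, its elements are uniquely \<open>a t + b t\<^sup>2 + c t\<^sup>3\<close>, and such an
  element is represented by its coefficient triple \<open>(a, b, c)\<close>.
\<close>

type_synonym 'a tilde = "'a \<times> 'a \<times> 'a"

definition tilde_scale :: "('f \<Rightarrow> 'a \<Rightarrow> 'a) \<Rightarrow> 'f \<Rightarrow> 'a tilde \<Rightarrow> 'a tilde" where
  "tilde_scale s r = (\<lambda>(a, b, c). (s r a, s r b, s r c))"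

text \<open>
  \<open>tilde_monom x n\<close> is the element \<open>x t\<^sup>n\<close> for \<open>n \<ge> 1\<close>; it vanishes for \<open>n \<ge> 4\<close> because
  \<open>t\<^sup>4 = 0\<close>. (The value at \<open>n = 0\<close> is irrelevant.)
\<close>

definition tilde_monom :: "'a::zero \<Rightarrow> nat \<Rightarrow> 'a tilde" where
  "tilde_monom x n = (if n = 1 then x else 0, if n = 2 then x else 0, if n = 3 then x else 0)"

definition tilde_coeff :: "'a tilde \<Rightarrow> nat \<Rightarrow> 'a" where
  "tilde_coeff p n = (case p of (a, b, c) \<Rightarrow> if n = 1 then a else if n = 2 then b else c)"

definition tilde_prod ::
    "('a \<Rightarrow> 'a \<Rightarrow> 'a \<Rightarrow> 'a::ab_group_add) \<Rightarrow> 'a tilde \<Rightarrow> 'a tilde \<Rightarrow> 'a tilde \<Rightarrow> 'a tilde" where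
  "tilde_prod T p q r = (\<Sum>i\<in>{1..3}. \<Sum>j\<in>{1..3}. \<Sum>k\<in>{1..3}.
     tilde_monom (T (tilde_coeff p i) (tilde_coeff q j) (tilde_coeff r k)) (i + j + k))"

lemma tilde_prod_eq: "tilde_prod T p q r = (0, 0, T (fst p) (fst q) (fst r))"
proof -
  have *: "{1..3::nat} = {1, 2, 3}" by auto
  show ?thesis
    unfolding tilde_prod_def *
    by (simp add: tilde_monom_def tilde_coeff_def zero_prod_def split_beta)
qed

lemma tilde_prod_monom:
  assumes "\<And>x y. T 0 x y = 0" "\<And>x y. T x 0 y = 0" "\<And>x y. T x y 0 = 0"
    and "i \<in> {1..3}" "j \<in> {1..3}" "k \<in> {1..3}"
  shows "tilde_prod T (tilde_monom x i) (tilde_monom y j) (tilde_monom z k) =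
    tilde_monom (T x y z) (i + j + k)"
  using assms by (auto simp: tilde_monom_def tilde_prod_eq)

text \<open>
  The component in \<open>product_span s T\<close> along \<open>U\<close>, meaningful when the whole space is the direct
  sum of \<open>U\<close> and \<open>product_span s T\<close>.
\<close>

definition product_part ::
    "('f::field \<Rightarrow> 'a::ab_group_add \<Rightarrow> 'a) \<Rightarrow> ('a \<Rightarrow> 'a \<Rightarrow> 'a \<Rightarrow> 'a) \<Rightarrow> 'a set \<Rightarrow> 'a \<Rightarrow> 'a" where
  "product_part s T U d = (THE c. c \<in> product_span s T \<and> (\<exists>u\<in>U. d = c + u))"

text \<open>
  The map \<open>l\<^sub>u\<close>. The choice of \<open>f'\<close> is immaterial: see \<open>l_u_eq\<close> below.
\<close>

definition l_u ::
    "('f::field \<Rightarrow> 'a::ab_group_add \<Rightarrow> 'a) \<Rightarrow> ('a \<Rightarrow> 'a \<Rightarrow> 'a \<Rightarrow> 'a) \<Rightarrow> 'a set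
      \<Rightarrow> ('a \<Rightarrow> 'a) \<Rightarrow> 'a tilde \<Rightarrow> 'a tilde" where
  "l_u s T U f = (let f' = (SOME f'. quasi_companion s T f f') in
     (\<lambda>(a, b, d). tilde_monom (f a) 1 + tilde_monom (f' (product_part s T U d)) 3))"

text \<open>
  Pointwise scalar multiplication on maps; addition of maps is that of
  \<^theory>\<open>HOL-Library.Function_Algebras\<close>.
\<close>

definition map_scale :: "('f \<Rightarrow> 'v \<Rightarrow> 'v) \<Rightarrow> 'f \<Rightarrow> ('w \<Rightarrow> 'v) \<Rightarrow> 'w \<Rightarrow> 'v" where
  "map_scale s r g = (\<lambda>x. s r (g x))"

lemma vector_space_map_scale:
  assumes "vector_space s"
  shows "vector_space (map_scale s)"
proof -
  interpret vector_space s by fact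
  show ?thesis
    by standard (auto simp: map_scale_def scale_right_distrib scale_left_distrib fun_eq_iff)
qed

lemma vector_space_tilde_scale:
  assumes "vector_space s"
  shows "vector_space (tilde_scale s)"
proof -
  interpret vector_space s by fact
  show ?thesis
    by standard (auto simp: tilde_scale_def scale_right_distrib scale_left_distrib)
qed

context ternary_jordan_algebra
begin

lemma quasi_companion_unique:
  assumes f': "quasi_companion scale T f f'" and f'': "quasi_companion scale T f f''"
    and w: "w \<in> product_span scale T"
  shows "f' w = f'' w"
proof -
  interpret m: vector_space_pair scale scale ..
  show ?thesis
  proof (rule m.linear_eq_on[of f' f'' w "{T x y z | x y z. True}"])
    fix b assume "b \<in> {T x y z | x y z. True}"
    with f' f'' show "f' b = f'' b"
      unfolding quasi_companion_def by fastforce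
  qed (use f' f'' w in \<open>auto simp: quasi_companion_def product_span_def\<close>)
qed

lemma product_part_eq:
  assumes "is_direct_sum scale UNIV U (product_span scale T)"
    and c: "c \<in> product_span scale T" and u: "u \<in> U"
  shows "product_part scale T U (c + u) = c"
  unfolding product_part_def
proof (rule the_equality)
  fix c' assume c': "c' \<in> product_span scale T \<and> (\<exists>u'\<in>U. c + u = c' + u')"
  then obtain u' where u': "u' \<in> U" "c + u = c' + u'" by blast
  have sub: "subspace U" "subspace (product_span scale T)"
    and int: "U \<inter> product_span scale T = {0}"
    using assms(1) by (auto simp: is_direct_sum_def)
  have "c' - c = u - u'" using u'(2) by (simp add: algebra_simps)
  moreover have "c' - c \<in> product_span scale T" using sub c c' by (blast intro: subspace_diff)
  moreover have "u - u' \<in> U" using sub u u' by (blast intro: subspace_diff)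
  ultimately have "c' - c = 0" using int by (metis Int_iff singletonD)
  then show "c' = c" by simp
qed (use c u in blast)

lemma l_u_eq:
  assumes "is_direct_sum scale UNIV U (product_span scale T)"
    and f': "quasi_companion scale T f f'"
    and "c \<in> product_span scale T" and "u \<in> U"
  shows "l_u scale T U f (a, b, c + u) = (f a, 0, f' c)"
proof -
  have "quasi_companion scale T f (SOME f'. quasi_companion scale T f f')"
    using f' by (rule someI[of "quasi_companion scale T f"])
  from quasi_companion_unique[OF this f' assms(3)] show ?thesis
    by (simp add: l_u_def Let_def product_part_eq[OF assms(1,3,4)] tilde_monom_def)
qed

lemma tilde_ternary_jordan_algebra:
  "ternary_jordan_algebra (tilde_scale scale) (tilde_prod T)"
proof -
  interpret t: vector_space "tilde_scale scale"
    by (rule vector_space_tilde_scale) (rule vector_space_axioms)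
  have add: "T (x + x') y z = T x y z + T x' y z" "T x (y + y') z = T x y z + T x y' z"
    "T x y (z + z') = T x y z + T x y z'" for x x' y y' z z'
    using linear_1 linear_2 linear_3 by (auto simp: Vector_Spaces.linear_iff)
  have smult: "T (scale r x) y z = scale r (T x y z)" "T x (scale r y) z = scale r (T x y z)"
    "T x y (scale r z) = scale r (T x y z)" for r x y z
    using linear_1 linear_2 linear_3 by (auto simp: Vector_Spaces.linear_iff)
  have zero: "T 0 y z = 0" "T x 0 z = 0" "T x y 0 = 0" for x y z
    using smult(1)[of 0 0 y z] smult(2)[of x 0 0 z] smult(3)[of x y 0 0] by auto
  have scale_eq: "tilde_scale scale r p = (scale r (fst p), scale r (fst (snd p)), scale r (snd (snd p)))"
    for r p
    by (simp add: tilde_scale_def split_beta)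
  have vs: "vector_space (tilde_scale scale)" ..
  show ?thesis
    by unfold_locales
      (simp_all add: Vector_Spaces.linear_iff vs tilde_prod_eq scale_eq add smult zero symmetric
        derivations_def commutator_def right_mult_def zero_prod_def)
qed

end

end

theory Submission imports Defs begin

text \<open>
  A product in \<open>A t + A t\<^sup>2 + A t\<^sup>3\<close> only sees the coefficients of \<open>t\<close>, so \<open>Z(A) = 0\<close> makes
  \<open>A t\<^sup>2 + A t\<^sup>3\<close> the center. Comparing the values of a derivation \<open>D\<close> on products containing
  a central factor shows that \<open>D\<close> preserves the center. Hence \<open>D\<close> induces a map \<open>f\<close> on the quotient
  \<open>A t\<close>, and its values on products \<open>[x t, y t, z t]\<close> exhibit \<open>f\<close> as a quasiderivation whose companion
  is the \<open>t\<^sup>3\<close>-component of \<open>D\<close> on \<open>A t\<^sup>3\<close>. The difference \<open>D - l\<^sub>u(f)\<close> maps into the center and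
  kills the products.
\<close>

lemma linear_imp_zero: "Vector_Spaces.linear s t f \<Longrightarrow> f 0 = 0"
  unfolding Vector_Spaces.linear_iff by (metis add_cancel_right_right)

section \<open>Trilinearity, and companions of combinations of quasiderivations\<close>

context ternary_jordan_algebra
begin

lemma T_add: "T (x + x') y z = T x y z + T x' y z" "T x (y + y') z = T x y z + T x y' z"
  "T x y (z + z') = T x y z + T x y z'"
  using linear_1 linear_2 linear_3 by (auto simp: Vector_Spaces.linear_iff)

lemma T_scale: "T (scale r x) y z = scale r (T x y z)" "T x (scale r y) z = scale r (T x y z)"
  "T x y (scale r z) = scale r (T x y z)"
  using linear_1 linear_2 linear_3 by (auto simp: Vector_Spaces.linear_iff)

lemma T_zero: "T 0 y z = 0" "T x 0 z = 0" "T x y 0 = 0"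
  using T_scale(1)[of 0 0 y z] T_scale(2)[of x 0 0 z] T_scale(3)[of x y 0 0] by auto

lemma product_in_product_span: "T x y z \<in> product_span scale T"
  unfolding product_span_def by (rule span_base) blast

lemma quasi_companion_zero: "quasi_companion scale T 0 0"
  by (auto simp: quasi_companion_def Vector_Spaces.linear_iff vector_space_axioms T_zero)

lemma quasi_companion_add:
  assumes "quasi_companion scale T f f'" "quasi_companion scale T g g'"
  shows "quasi_companion scale T (f + g) (f' + g')"
proof -
  have "T (f x) y z + T x (f y) z + T x y (f z) = f' (T x y z)"
    "T (g x) y z + T x (g y) z + T x y (g z) = g' (T x y z)" for x y z
    using assms by (auto simp: quasi_companion_def)
  from this[symmetric] assms show ?thesis
    by (auto simp: quasi_companion_def Vector_Spaces.linear_iff T_add scale_right_distrib)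
qed

lemma quasi_companion_scale:
  assumes "quasi_companion scale T f f'"
  shows "quasi_companion scale T (map_scale scale r f) (map_scale scale r f')"
proof -
  have "T (f x) y z + T x (f y) z + T x y (f z) = f' (T x y z)" for x y z
    using assms by (auto simp: quasi_companion_def)
  from this[symmetric] assms show ?thesis
    by (auto simp: quasi_companion_def Vector_Spaces.linear_iff T_scale scale_right_distrib
        map_scale_def scale_left_commute)
qed

section \<open>Center and derivations of the extended algebra\<close>

lemma tilde_center_derivations_subset:
  "center_derivations (tilde_scale scale) (tilde_prod T)
    \<subseteq> derivations (tilde_scale scale) (tilde_prod T)"
proof
  interpret t: ternary_jordan_algebra "tilde_scale scale" "tilde_prod T"
    by (rule tilde_ternary_jordan_algebra)
  fix D assume D: "D \<in> center_derivations (tilde_scale scale) (tilde_prod T)"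
  then have "tilde_prod T p q (D r) = 0" for p q r
    by (auto simp: center_derivations_def algebra_center_def simp del: split_paired_All)
  \<comment> \<open>The center is defined through the third slot only; symmetry moves the central
    factor to the other two. With \<open>D\<close> also killing products, both sides of the Leibniz
    rule vanish.\<close>
  then have "tilde_prod T p q (D r) = 0" "tilde_prod T p (D q) r = 0" "tilde_prod T (D p) q r = 0"
    for p q r
    using t.symmetric(1)[of p r "D q"] t.symmetric(3)[of q r "D p"] by metis+
  moreover have "D (tilde_prod T p q r) = 0" for p q r
    using D t.product_in_product_span by (auto simp: center_derivations_def)
  ultimately show "D \<in> derivations (tilde_scale scale) (tilde_prod T)"
    using D by (simp add: derivations_def center_derivations_def)
qed

text \<open>Kept general in the algebra so that the theorem can instantiate it at
  \<open>tilde_prod T\<close>.\<close>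

lemma subspace_center_derivations:
  "module.subspace (map_scale scale) (center_derivations scale T)"
proof -
  interpret m: vector_space "map_scale scale :: _ \<Rightarrow> ('a \<Rightarrow> 'a) \<Rightarrow> _"
    by (rule vector_space_map_scale) (rule vector_space_axioms)
  show ?thesis
    by (auto simp: m.subspace_def center_derivations_def algebra_center_def map_scale_def
        Vector_Spaces.linear_iff vector_space_axioms T_zero T_add T_scale image_subset_iff
        scale_right_distrib scale_left_commute algebra_simps)
qed

lemma tilde_center_iff:
  assumes "algebra_center T = {0}"
  shows "p \<in> algebra_center (tilde_prod T) \<longleftrightarrow> fst p = 0"
proof
  assume "p \<in> algebra_center (tilde_prod T)"
  \<comment> \<open>Testing against \<open>x t\<close> and \<open>y t\<close> suffices to place the
    \<open>t\<close>-coefficient of \<open>p\<close> in the center of the original algebra.\<close>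
  then have "tilde_prod T (x, 0, 0) (y, 0, 0) p = 0" for x y
    by (auto simp: algebra_center_def)
  then have "fst p \<in> algebra_center T"
    by (auto simp: algebra_center_def tilde_prod_eq zero_prod_def)
  with assms show "fst p = 0" by simp
qed (auto simp: algebra_center_def tilde_prod_eq T_zero zero_prod_def)

text \<open>The element \<open>(0, b, c)\<close> annihilates all products, so the Leibniz rule for
  \<open>[p, q, (0, b, c)]\<close> reduces to \<open>[p, q, D (0, b, c)] = 0\<close>; thus its image
  is central too.\<close>

lemma tilde_derivation_fst_eq_0:
  assumes Z: "algebra_center T = {0}"
    and D: "D \<in> derivations (tilde_scale scale) (tilde_prod T)"
  shows "fst (D (0, b, c)) = 0"
proof -
  interpret t: ternary_jordan_algebra "tilde_scale scale" "tilde_prod T"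
    by (rule tilde_ternary_jordan_algebra)
  have "D 0 = 0"
    using D by (auto simp: derivations_def dest: linear_imp_zero)
  have "tilde_prod T p q (D (0, b, c)) = 0" for p q
  proof -
    have "D (tilde_prod T p q (0, b, c)) = tilde_prod T (D p) q (0, b, c) +
        tilde_prod T p (D q) (0, b, c) + tilde_prod T p q (D (0, b, c))"
      using D by (simp add: derivations_def del: split_paired_All)
    with \<open>D 0 = 0\<close> show ?thesis by (simp add: tilde_prod_eq T_zero zero_prod_def)
  qed
  then have "D (0, b, c) \<in> algebra_center (tilde_prod T)"
    by (simp add: algebra_center_def)
  then show ?thesis using tilde_center_iff[OF Z] by simp
qed

section \<open>The projection along \<open>U\<close> and the map \<open>l_u\<close>\<close>

context
  fixes U
  assumes dec: "is_direct_sum scale UNIV U (product_span scale T)"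
begin

lemma product_part_decomposition:
  obtains u where "u \<in> U" "d = product_part scale T U d + u"
    "product_part scale T U d \<in> product_span scale T"
proof -
  obtain u c where "u \<in> U" "c \<in> product_span scale T" "d = u + c"
    using dec unfolding is_direct_sum_def by blast
  then show ?thesis
    using product_part_eq[OF dec, of c u] that[of u] by (simp add: add.commute)
qed

lemma product_part_ident: "c \<in> product_span scale T \<Longrightarrow> product_part scale T U c = c"
  using product_part_eq[OF dec, of c 0] dec by (auto simp: is_direct_sum_def subspace_0)

text \<open>Adding or scaling decompositions gives a decomposition again, and
  \<open>product_part_eq\<close> says that decompositions are unique.\<close>

lemma linear_product_part: "Vector_Spaces.linear scale scale (product_part scale T U)"
proof -
  have sub: "subspace U" "subspace (product_span scale T)"
    using dec by (auto simp: is_direct_sum_def)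
  have "product_part scale T U (d + e) = product_part scale T U d + product_part scale T U e" for d e
  proof -
    obtain u where u: "u \<in> U" "d = product_part scale T U d + u"
      "product_part scale T U d \<in> product_span scale T"
      by (rule product_part_decomposition)
    obtain v where v: "v \<in> U" "e = product_part scale T U e + v"
      "product_part scale T U e \<in> product_span scale T"
      by (rule product_part_decomposition)
    have "d + e = (product_part scale T U d + product_part scale T U e) + (u + v)"
      using u(2) v(2) by (metis add.assoc add.left_commute)
    then show ?thesis
      using product_part_eq[OF dec] u v sub by (metis subspace_add)
  qed
  moreover have "product_part scale T U (scale r d) = scale r (product_part scale T U d)" for r d
  proof -
    obtain u where u: "u \<in> U" "d = product_part scale T U d + u"
      "product_part scale T U d \<in> product_span scale T"
      by (rule product_part_decomposition)
    have "scale r d = scale r (product_part scale T U d) + scale r u"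
      using u(2) by (metis scale_right_distrib)
    then show ?thesis
      using product_part_eq[OF dec] u sub by (metis subspace_scale)
  qed
  ultimately show ?thesis
    by (simp add: Vector_Spaces.linear_iff vector_space_axioms)
qed

text \<open>Frees \<open>l_u_eq\<close> from arguments already split as \<open>c + u\<close>, and
  replaces the companion chosen by \<open>SOME\<close> with any convenient one.\<close>

lemma l_u_apply:
  assumes "quasi_companion scale T f f'"
  shows "l_u scale T U f p = (f (fst p), 0, f' (product_part scale T U (snd (snd p))))"
proof -
  obtain u where "u \<in> U" "snd (snd p) = product_part scale T U (snd (snd p)) + u"
    "product_part scale T U (snd (snd p)) \<in> product_span scale T"
    by (rule product_part_decomposition)
  then show ?thesis
    using l_u_eq[OF dec assms, of _ u "fst p" "fst (snd p)"] by (metis prod.collapse)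
qed

text \<open>The product has only a \<open>t^3\<close>-coefficient, which lies in the product span,
  where the projection is the identity. The Leibniz rule then becomes the companion identity for
  \<open>f\<close> and \<open>f'\<close>.\<close>

lemma l_u_derivation:
  assumes "f \<in> quasiderivations scale T"
  shows "l_u scale T U f \<in> derivations (tilde_scale scale) (tilde_prod T)"
proof -
  from assms obtain f' where lf: "Vector_Spaces.linear scale scale f"
    and f': "quasi_companion scale T f f'"
    by (auto simp: quasiderivations_def)
  have eq: "T (f x) y z + T x (f y) z + T x y (f z) = f' (T x y z)"
    and lf': "Vector_Spaces.linear scale scale f'" for x y z
    using f' by (auto simp: quasi_companion_def)
  have lp: "Vector_Spaces.linear scale scale (product_part scale T U)"
    by (rule linear_product_part)
  have "f 0 = 0" using lf by (rule linear_imp_zero)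
  with lf lf' lp show ?thesis
    by (auto simp: derivations_def l_u_apply[OF f'] tilde_prod_eq
        product_part_ident[OF product_in_product_span] eq tilde_scale_def
        vector_space_tilde_scale Vector_Spaces.linear_iff)
qed

text \<open>The choice of a companion by \<open>SOME\<close> need not be linear in \<open>f\<close>,
  but sums and multiples of companions are companions, and \<open>l_u_apply\<close> accepts
  those.\<close>

lemma subspace_l_u_image:
  "module.subspace (map_scale (tilde_scale scale)) (l_u scale T U ` quasiderivations scale T)"
proof -
  interpret m: vector_space "map_scale (tilde_scale scale) :: _ \<Rightarrow> ('a tilde \<Rightarrow> _) \<Rightarrow> _"
    by (intro vector_space_map_scale vector_space_tilde_scale vector_space_axioms)
  show ?thesis
  proof (rule m.subspaceI)
    have "l_u scale T U 0 = 0"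
      by (simp add: fun_eq_iff l_u_apply[OF quasi_companion_zero] zero_prod_def)
    moreover have "0 \<in> quasiderivations scale T"
      using quasi_companion_zero
      by (auto simp: quasiderivations_def quasi_companion_def)
    ultimately show "0 \<in> l_u scale T U ` quasiderivations scale T" by (metis imageI)
  next
    fix F G assume "F \<in> l_u scale T U ` quasiderivations scale T"
      "G \<in> l_u scale T U ` quasiderivations scale T"
    then obtain f g f' g' where F: "F = l_u scale T U f" "quasi_companion scale T f f'"
      "Vector_Spaces.linear scale scale f"
      and G: "G = l_u scale T U g" "quasi_companion scale T g g'"
      "Vector_Spaces.linear scale scale g"
      by (auto simp: quasiderivations_def)
    note c = quasi_companion_add[OF F(2) G(2)]
    have "F + G = l_u scale T U (f + g)"
      by (simp add: fun_eq_iff F(1) G(1) l_u_apply[OF c] l_u_apply[OF F(2)] l_u_apply[OF G(2)])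
    moreover have "f + g \<in> quasiderivations scale T"
      using c F(3) G(3)
      by (auto simp: quasiderivations_def Vector_Spaces.linear_iff scale_right_distrib)
    ultimately show "F + G \<in> l_u scale T U ` quasiderivations scale T" by blast
  next
    fix r F assume "F \<in> l_u scale T U ` quasiderivations scale T"
    then obtain f f' where F: "F = l_u scale T U f" "quasi_companion scale T f f'"
      "Vector_Spaces.linear scale scale f"
      by (auto simp: quasiderivations_def)
    note c = quasi_companion_scale[OF F(2), of r]
    have "map_scale (tilde_scale scale) r F = l_u scale T U (map_scale scale r f)"
      by (simp add: fun_eq_iff F(1) l_u_apply[OF c] l_u_apply[OF F(2)])
        (simp add: map_scale_def l_u_apply[OF F(2)] tilde_scale_def)
    moreover have "map_scale scale r f \<in> quasiderivations scale T"
      using c F(3)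
      by (auto simp: quasiderivations_def Vector_Spaces.linear_iff scale_right_distrib
          map_scale_def scale_left_commute)
    ultimately show "map_scale (tilde_scale scale) r F \<in> l_u scale T U ` quasiderivations scale T"
      by blast
  qed
qed

lemma l_u_center_derivation_eq_0:
  assumes Z: "algebra_center T = {0}" and f: "f \<in> quasiderivations scale T"
    and c: "l_u scale T U f \<in> center_derivations (tilde_scale scale) (tilde_prod T)"
  shows "l_u scale T U f = 0"
proof -
  from f obtain f' where f': "quasi_companion scale T f f'"
    by (auto simp: quasiderivations_def)
  have "f a = 0" for a
  proof -
    have "l_u scale T U f (a, 0, 0) \<in> algebra_center (tilde_prod T)"
      using c by (auto simp: center_derivations_def)
    then show ?thesis by (simp add: tilde_center_iff[OF Z] l_u_apply[OF f'])
  qed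
  \<comment> \<open>Since \<open>f\<close> vanishes, the zero map may stand in for
    \<open>f'\<close>, which makes the \<open>t^3\<close>-coefficient vanish as well.\<close>
  then have "quasi_companion scale T f 0"
    using quasi_companion_zero by (metis ext zero_fun_apply)
  from l_u_apply[OF this] \<open>\<And>a. f a = 0\<close> show ?thesis
    by (simp add: fun_eq_iff zero_prod_def)
qed

section \<open>Splitting a derivation of the extended algebra\<close>

lemma tilde_derivation_decomposition:
  assumes Z: "algebra_center T = {0}"
    and D: "D \<in> derivations (tilde_scale scale) (tilde_prod T)"
  obtains f where "f \<in> quasiderivations scale T"
    "D - l_u scale T U f \<in> center_derivations (tilde_scale scale) (tilde_prod T)"
proof -
  interpret t: vector_space "tilde_scale scale"
    by (rule vector_space_tilde_scale) (rule vector_space_axioms)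
  interpret tp: vector_space_pair "tilde_scale scale" "tilde_scale scale" ..
  define f where "f a = fst (D (a, 0, 0))" for a
  define f' where "f' c = snd (snd (D (0, 0, c)))" for c
  have lin: "Vector_Spaces.linear (tilde_scale scale) (tilde_scale scale) D"
    using D by (simp add: derivations_def)
  have Dadd: "D (p + q) = D p + D q" and Dscale: "D (tilde_scale scale r p) = tilde_scale scale r (D p)"
    for p q r
    using lin by (simp_all add: Vector_Spaces.linear_iff del: split_paired_All)
  \<comment> \<open>The central summand \<open>(0, snd p)\<close> of \<open>p\<close> contributes
    nothing to the \<open>t\<close>-coefficient.\<close>
  have fst_D: "fst (D p) = f (fst p)" for p
  proof -
    have "D p = D (fst p, 0, 0) + D (0, snd p)"
      unfolding Dadd[symmetric] by (simp flip: zero_prod_def)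
    then show ?thesis
      using tilde_derivation_fst_eq_0[OF Z D] by (metis f_def fst_add add_0_right prod.collapse)
  qed
  \<comment> \<open>Leibniz on \<open>[x t, y t, z t]\<close>: each term sees only
    \<open>t\<close>-coefficients, which are given by \<open>f\<close>. The
    \<open>t^2\<close>-coefficient also comes out zero, matching \<open>l_u\<close>.\<close>
  have D_prod: "D (0, 0, T x y z) = (0, 0, T (f x) y z + T x (f y) z + T x y (f z))" for x y z
  proof -
    have "D (tilde_prod T (x, 0, 0) (y, 0, 0) (z, 0, 0)) = tilde_prod T (D (x, 0, 0)) (y, 0, 0) (z, 0, 0) +
        tilde_prod T (x, 0, 0) (D (y, 0, 0)) (z, 0, 0) + tilde_prod T (x, 0, 0) (y, 0, 0) (D (z, 0, 0))"
      using D by (simp add: derivations_def)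
    then show ?thesis by (simp add: tilde_prod_eq fst_D)
  qed
  have "Vector_Spaces.linear scale scale f'"
  proof -
    have "f' (c + d) = f' c + f' d" for c d
      using Dadd[of "(0, 0, c)" "(0, 0, d)"] by (simp add: f'_def)
    moreover have "f' (scale r c) = scale r (f' c)" for r c
      using Dscale[of r "(0, 0, c)"] by (simp add: f'_def tilde_scale_def split_beta)
    ultimately show ?thesis by (simp add: Vector_Spaces.linear_iff vector_space_axioms)
  qed
  then have f': "quasi_companion scale T f f'"
    by (simp add: quasi_companion_def f'_def D_prod)
  have "Vector_Spaces.linear scale scale f"
  proof -
    have "f (c + d) = f c + f d" for c d
      using Dadd[of "(c, 0, 0)" "(d, 0, 0)"] by (simp add: f_def)
    moreover have "f (scale r c) = scale r (f c)" for r c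
      using Dscale[of r "(c, 0, 0)"] by (simp add: f_def tilde_scale_def split_beta)
    ultimately show ?thesis by (simp add: Vector_Spaces.linear_iff vector_space_axioms)
  qed
  with f' have f: "f \<in> quasiderivations scale T"
    by (auto simp: quasiderivations_def)
  let ?E = "D - l_u scale T U f"
  have "Vector_Spaces.linear (tilde_scale scale) (tilde_scale scale) (l_u scale T U f)"
    using l_u_derivation[OF f] by (simp add: derivations_def)
  with lin have linE: "Vector_Spaces.linear (tilde_scale scale) (tilde_scale scale) ?E"
    unfolding fun_diff_def by (rule tp.linear_compose_sub)
  \<comment> \<open>By linearity it suffices to treat a single product, on which \<open>D\<close>
    and \<open>l_u scale T U f\<close> both give \<open>f' (T x y z)\<close> in degree 3 and zero
    elsewhere.\<close>
  have "?E w = 0" if "w \<in> product_span (tilde_scale scale) (tilde_prod T)" for w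
  proof (rule tp.linear_eq_0_on_span[OF linE])
    show "w \<in> t.span {tilde_prod T x y z | x y z. True}"
      using that by (simp add: product_span_def)
    have "T (f x) y z + T x (f y) z + T x y (f z) = f' (T x y z)" for x y z
      using f' by (auto simp: quasi_companion_def)
    moreover have "f 0 = 0"
      using \<open>Vector_Spaces.linear scale scale f\<close> by (rule linear_imp_zero)
    ultimately show "?E p = 0" if "p \<in> {tilde_prod T x y z | x y z. True}" for p
      using that by (auto simp: tilde_prod_eq D_prod l_u_apply[OF f']
          product_part_ident[OF product_in_product_span] zero_prod_def)
  qed
  \<comment> \<open>Both maps have \<open>t\<close>-coefficient \<open>f (fst p)\<close>, so it
    cancels in the difference.\<close>
  moreover have "?E p \<in> algebra_center (tilde_prod T)" for p
    by (simp add: tilde_center_iff[OF Z] fst_D l_u_apply[OF f'])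
  ultimately have "?E \<in> center_derivations (tilde_scale scale) (tilde_prod T)"
    using linE by (auto simp: center_derivations_def)
  with f show ?thesis by (rule that)
qed

end

end

theorem theorem5p3:
  fixes scale :: "'f::field \<Rightarrow> 'a::ab_group_add \<Rightarrow> 'a"
    and T :: "'a \<Rightarrow> 'a \<Rightarrow> 'a \<Rightarrow> 'a"
    and U :: "'a set"
  assumes "ternary_jordan_algebra scale T"
    and "is_direct_sum scale UNIV U (product_span scale T)"
    and "algebra_center T = {0}"
  shows "is_direct_sum (map_scale (tilde_scale scale))
           (derivations (tilde_scale scale) (tilde_prod T))
           (l_u scale T U ` quasiderivations scale T)
           (center_derivations (tilde_scale scale) (tilde_prod T))"
proof -
  interpret ternary_jordan_algebra scale T by fact
  interpret t: ternary_jordan_algebra "tilde_scale scale" "tilde_prod T"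
    by (rule tilde_ternary_jordan_algebra)
  let ?L = "l_u scale T U ` quasiderivations scale T"
  let ?Z = "center_derivations (tilde_scale scale) (tilde_prod T)"
  let ?D = "derivations (tilde_scale scale) (tilde_prod T)"
  interpret m: vector_space "map_scale (tilde_scale scale) :: _ \<Rightarrow> ('a tilde \<Rightarrow> _) \<Rightarrow> _"
    by (intro vector_space_map_scale vector_space_tilde_scale vector_space_axioms)
  have L: "m.subspace ?L" by (rule subspace_l_u_image[OF assms(2)])
  have Z: "m.subspace ?Z" by (rule t.subspace_center_derivations)
  \<comment> \<open>Both summands consist of derivations, so closure under addition gives the
    inclusion of the sum in \<open>?D\<close>.\<close>
  have "F + G \<in> ?D" if "F \<in> ?D" "G \<in> ?D" for F G
    using that
    by (auto simp: derivations_def Vector_Spaces.linear_iff t.T_add t.scale_right_distrib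
        add.assoc add.left_commute)
  then have "F + G \<in> ?D" if "F \<in> ?L" "G \<in> ?Z" for F G
    using that l_u_derivation[OF assms(2)] tilde_center_derivations_subset by blast
  moreover have "\<exists>F G. D = F + G \<and> F \<in> ?L \<and> G \<in> ?Z" if D: "D \<in> ?D" for D
  proof -
    obtain f where "f \<in> quasiderivations scale T" "D - l_u scale T U f \<in> ?Z"
      by (rule tilde_derivation_decomposition[OF assms(2,3) D])
    then show ?thesis by (metis add.commute diff_add_cancel imageI)
  qed
  ultimately have "?D = {F + G | F G. F \<in> ?L \<and> G \<in> ?Z}" by blast
  moreover have "?L \<inter> ?Z = {0}"
    using l_u_center_derivation_eq_0[OF assms(2,3)] m.subspace_0[OF L] m.subspace_0[OF Z] by blast
  ultimately show ?thesis using L Z by (simp add: is_direct_sum_def)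
qed

end
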